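(* Suppose $X_1,\dots,X_n$ are i.i.d. $\mathrm{Exp}(\theta)$ with rate $\theta>0$, and let $\tau^*$ be the optimal full-information stopping rule. Then, as $n\to\infty$, $$\mathrm{CR}_n(\tau^*;\theta)=1-\Theta\!\left(\frac1{\log n}\right).$$
   Context: Stopping problem: $X_1,\dots,X_n$ are observed sequentially and $X_{n+1}:=0$. A policy is a stopping time $\tau\in\{1,\dots,n\}\cup\{n+1\}$ adapted to $(X_t)$, with reward $X_\tau$. $\mathrm{OPT}(\theta):=\mathbb E_\theta[\max_{t\in[n]}X_t]$ and $\mathrm{CR}_n(\tau;\theta):=\mathbb E_\theta[X_\tau]/\mathrm{OPT}(\theta)$. The optimal full-information stopping rule $\tau^*$ is the stopping time maximizing $\mathbb E_\theta[X_\tau]$ when $\theta$ is known. $A_n=1-\Theta(b_n)$ means that $1-A_n$ lies between two positive constant multiples of $b_n$ for all large $n$. *)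

theory Defs
  imports "HOL-Probability.Probability"
begin

text \<open>The observations are \<open>X 1, \<dots>, X n\<close>; only these indices of \<open>X\<close> are ever used.  The value at
  \<open>n + 1\<close> (no observation accepted) is \<open>0\<close> by convention.\<close>

definition padded :: "nat \<Rightarrow> (nat \<Rightarrow> 'a \<Rightarrow> real) \<Rightarrow> nat \<Rightarrow> 'a \<Rightarrow> real" where
  "padded n X t \<omega> = (if 1 \<le> t \<and> t \<le> n then X t \<omega> else 0)"

definition natural_filtration :: "'a measure \<Rightarrow> (nat \<Rightarrow> 'a \<Rightarrow> real) \<Rightarrow> nat \<Rightarrow> 'a measure" where
  "natural_filtration M Y t =
     sigma (space M) (\<Union>i\<in>{1..t}. {Y i -` B \<inter> space M | B. B \<in> sets borel})"

lemma filtration_natural_filtration: "filtration (space M) (natural_filtration M Y)"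
proof
  show "space (natural_filtration M Y i) = space M" for i
    by (auto simp: natural_filtration_def intro!: space_measure_of)
next
  fix i j :: nat assume "i \<le> j"
  let ?G = "\<lambda>t. \<Union>k\<in>{1..t}. {Y k -` B \<inter> space M | B. B \<in> sets borel}"
  have "sets (natural_filtration M Y t) = sigma_sets (space M) (?G t)" for t
    unfolding natural_filtration_def by (rule sets_measure_of) auto
  moreover have "?G i \<subseteq> ?G j"
    using \<open>i \<le> j\<close> by (intro UN_mono atLeastatMost_subset_iff[THEN iffD2] order_refl) simp
  ultimately show "sets (natural_filtration M Y i) \<subseteq> sets (natural_filtration M Y j)"
    by (simp only: sigma_sets_mono')
qed

definition is_policy ::
    "'a measure \<Rightarrow> nat \<Rightarrow> (nat \<Rightarrow> 'a \<Rightarrow> real) \<Rightarrow> ('a \<Rightarrow> nat) \<Rightarrow> bool" where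
  "is_policy M n X \<tau> \<longleftrightarrow>
     stopping_time (natural_filtration M (padded n X)) \<tau> \<and>
     (\<forall>\<omega>\<in>space M. \<tau> \<omega> \<in> {1..n + 1})"

definition expected_reward ::
    "'a measure \<Rightarrow> nat \<Rightarrow> (nat \<Rightarrow> 'a \<Rightarrow> real) \<Rightarrow> ('a \<Rightarrow> nat) \<Rightarrow> real" where
  "expected_reward M n X \<tau> = (\<integral>\<omega>. padded n X (\<tau> \<omega>) \<omega> \<partial>M)"

text \<open>Optimality is relative to the given law \<open>M\<close>, i.e. with its parameters known.\<close>

definition is_optimal_policy ::
    "'a measure \<Rightarrow> nat \<Rightarrow> (nat \<Rightarrow> 'a \<Rightarrow> real) \<Rightarrow> ('a \<Rightarrow> nat) \<Rightarrow> bool" where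
  "is_optimal_policy M n X \<tau> \<longleftrightarrow>
     is_policy M n X \<tau> \<and>
     (\<forall>\<sigma>. is_policy M n X \<sigma> \<longrightarrow> expected_reward M n X \<sigma> \<le> expected_reward M n X \<tau>)"

definition OPT :: "'a measure \<Rightarrow> nat \<Rightarrow> (nat \<Rightarrow> 'a \<Rightarrow> real) \<Rightarrow> real" where
  "OPT M n X = (\<integral>\<omega>. Max ((\<lambda>t. X t \<omega>) ` {1..n}) \<partial>M)"

definition CR :: "'a measure \<Rightarrow> nat \<Rightarrow> (nat \<Rightarrow> 'a \<Rightarrow> real) \<Rightarrow> ('a \<Rightarrow> nat) \<Rightarrow> real" where
  "CR M n X \<tau> = expected_reward M n X \<tau> / OPT M n X"

text \<open>\<open>A n = 1 - \<Theta>(b n)\<close>.  Unlike \<open>(\<lambda>n. 1 - A n) \<in> \<Theta>(b)\<close>, this bounds \<open>1 - A n\<close> itself and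
  not its absolute value.\<close>

definition one_minus_Theta :: "(nat \<Rightarrow> real) \<Rightarrow> (nat \<Rightarrow> real) \<Rightarrow> bool" where
  "one_minus_Theta A b \<longleftrightarrow>
     (\<exists>c>0. \<exists>C>0. \<forall>\<^sub>F n in sequentially. c * b n \<le> 1 - A n \<and> 1 - A n \<le> C * b n)"

end

theory Submission
  imports Defs "HOL-Real_Asymp.Real_Asymp"
begin

text \<open>With \<open>k\<close> observations left and rate \<open>1\<close>, backward induction gives the optimal value \<open>u\<^sub>k\<close>, where
  \<open>u\<^sub>0 = 0\<close> and \<open>u\<^sub>k\<^sub>+\<^sub>1 = E (max u\<^sub>k X) = u\<^sub>k + exp (- u\<^sub>k)\<close>; a rate \<open>\<theta>\<close> divides it by \<open>\<theta>\<close>.  The expected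
  maximum is \<open>H\<^sub>n / \<theta>\<close>, so the competitive ratio is \<open>u\<^sub>n / H\<^sub>n\<close>.  From \<open>exp u\<^sub>k\<^sub>+\<^sub>1 \<ge> exp u\<^sub>k + 1\<close> one gets
  \<open>u\<^sub>k \<ge> ln (k + 1)\<close>.  This bounds \<open>H\<^sub>k - u\<^sub>k\<close> above by \<open>1\<close>, and it makes \<open>H\<^sub>k - u\<^sub>k\<close> nondecreasing, because
  \<open>exp (- u\<^sub>k) \<le> 1 / (k + 1)\<close>; hence \<open>H\<^sub>n - u\<^sub>n \<ge> H\<^sub>2 - u\<^sub>2 = 1/2 - exp (- 1) > 0\<close> for \<open>n \<ge> 2\<close>.\<close>

section \<open>Expectations of functions of \<open>max m X\<close> for exponential
  \<open>X\<close>\<close>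

text \<open>Split at \<open>X = m\<close>. Below, the integrand is the constant \<open>h m\<close>,
  weighted by the distribution function. Above, \<open>F\<close> is an antiderivative of
  \<open>h\<close> times the density that vanishes at infinity, so this part contributes
  \<open>- F m\<close>.\<close>

lemma (in prob_space) exponential_expectation_comp_max:
  fixes X :: "'a \<Rightarrow> real" and h F :: "real \<Rightarrow> real"
  assumes D: "distributed M lborel X (exponential_density \<theta>)" and \<theta>: "0 < \<theta>" and m: "0 \<le> m"
    and h[measurable]: "h \<in> borel_measurable borel" and h0: "\<And>x. m \<le> x \<Longrightarrow> 0 \<le> h x"
    and F: "\<And>x. m \<le> x \<Longrightarrow> (F has_real_derivative h x * (\<theta> * exp (- \<theta> * x))) (at x)"
    and lim: "(F \<longlongrightarrow> 0) at_top"
  shows "has_bochner_integral M (\<lambda>\<omega>. h (max m (X \<omega>))) (h m * (1 - exp (- \<theta> * m)) - F m)"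
proof -
  have X[measurable]: "X \<in> borel_measurable M"
    using distributed_measurable[OF D] by simp
  let ?f = "\<lambda>x. h x * (\<theta> * exp (- \<theta> * x))"
  have f0: "0 \<le> ?f x" if "m \<le> x" for x
    using that h0 \<theta> by simp
  \<comment> \<open>\<open>F\<close> is nondecreasing with limit \<open>0\<close>, so
    \<open>- F m\<close> is nonnegative and survives the passage through
    \<open>ennreal\<close>.\<close>
  have "F m \<le> F x" if "m \<le> x" for x
    by (rule DERIV_nonneg_imp_nondecreasing[OF that]) (use F f0 in blast)
  then have Fm: "F m \<le> 0"
    using lim by (intro tendsto_lowerbound[OF lim]) (auto intro: eventually_at_top_linorderI[of m])
  have "(\<integral>\<^sup>+\<omega>. ennreal (indicator {m<..} (X \<omega>) * h (X \<omega>)) \<partial>M) =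
      (\<integral>\<^sup>+x. ennreal (exponential_density \<theta> x) * ennreal (indicator {m<..} x * h x) \<partial>lborel)"
    by (rule distributed_nn_integral[OF D, symmetric]) simp
  \<comment> \<open>The point \<open>m\<close> is a null set, and \<open>0 \<le> m\<close> keeps the
    range on the exponential branch of the density.\<close>
  also have "\<dots> = (\<integral>\<^sup>+x. ennreal (?f x) * indicator {m..} x \<partial>lborel)"
    using AE_lborel_singleton[of m] m \<theta>
    by (intro nn_integral_cong_AE)
      (auto elim!: eventually_mono simp: exponential_density_def ennreal_mult'[symmetric] mult_ac
        split: split_indicator)
  also have "\<dots> = ennreal (0 - F m)"
    by (rule nn_integral_FTC_atLeast[OF _ F f0 lim]) auto
  finally have "has_bochner_integral M (\<lambda>\<omega>. indicator {m<..} (X \<omega>) * h (X \<omega>)) (- F m)"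
    using Fm h0 by (intro has_bochner_integral_nn_integral) (auto split: split_indicator)
  moreover have "has_bochner_integral M (\<lambda>\<omega>. h m * indicator {\<omega>\<in>space M. X \<omega> \<le> m} \<omega>)
      (h m * (1 - exp (- \<theta> * m)))"
    using has_bochner_integral_real_indicator[of "{\<omega>\<in>space M. X \<omega> \<le> m}" M]
      exponential_distributedD_le[OF D m \<theta>]
    by (intro has_bochner_integral_mult_right) (simp add: mult.commute emeasure_eq_measure)
  ultimately have "has_bochner_integral M
      (\<lambda>\<omega>. h m * indicator {\<omega>\<in>space M. X \<omega> \<le> m} \<omega> + indicator {m<..} (X \<omega>) * h (X \<omega>))
      (h m * (1 - exp (- \<theta> * m)) + - F m)"
    by (intro has_bochner_integral_add)
  then show ?thesis
    by (rule has_bochner_integral_cong[OF refl _ _, THEN iffD1, rotated -1])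
      (auto split: split_indicator simp: max_def)
qed

text \<open>By memorylessness, an excess over \<open>m\<close> occurs with probability
  \<open>exp (- \<theta> * m)\<close> and has mean \<open>1 / \<theta>\<close>. This is the one-step
  formula for both the backward induction and the expected maximum.\<close>

lemma (in prob_space) exponential_expectation_max:
  fixes X :: "'a \<Rightarrow> real"
  assumes D: "distributed M lborel X (exponential_density \<theta>)" and \<theta>: "0 < \<theta>" and m: "0 \<le> m"
  shows "has_bochner_integral M (\<lambda>\<omega>. max m (X \<omega>)) (m + exp (- \<theta> * m) / \<theta>)"
proof -
  have "has_bochner_integral M (\<lambda>\<omega>. max m (X \<omega>))
      (m * (1 - exp (- \<theta> * m)) - (- (m + 1 / \<theta>) * exp (- \<theta> * m)))"
  proof (rule exponential_expectation_comp_max[OF D \<theta> m])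
    show "((\<lambda>x. - (x + 1 / \<theta>) * exp (- \<theta> * x)) \<longlongrightarrow> 0) at_top"
      using \<theta> by real_asymp
    show "((\<lambda>x. - (x + 1 / \<theta>) * exp (- \<theta> * x)) has_real_derivative x * (\<theta> * exp (- \<theta> * x))) (at x)" for x
      using \<theta> by (auto intro!: derivative_eq_intros simp: field_simps)
  qed (use m in auto)
  then show ?thesis
    by (simp add: algebra_simps)
qed

text \<open>Multiplying by the density raises the rate from \<open>j * \<theta>\<close> to
  \<open>Suc j * \<theta>\<close>, which is why order \<open>j + 1\<close> appears.\<close>

lemma (in prob_space) exponential_expectation_exp_max:
  fixes X :: "'a \<Rightarrow> real" and j :: nat and \<theta> m :: real
  assumes D: "distributed M lborel X (exponential_density \<theta>)" and \<theta>: "0 < \<theta>" and m: "0 \<le> m"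
  shows "has_bochner_integral M (\<lambda>\<omega>. exp (- (j * \<theta> * max m (X \<omega>))))
    (exp (- (j * \<theta> * m)) - real j / Suc j * exp (- (Suc j * \<theta> * m)))"
proof -
  have "has_bochner_integral M (\<lambda>\<omega>. exp (- (j * \<theta> * max m (X \<omega>))))
      (exp (- (j * \<theta> * m)) * (1 - exp (- \<theta> * m)) - (- (1 / Suc j) * exp (- (Suc j * \<theta> * m))))"
  proof (rule exponential_expectation_comp_max[OF D \<theta> m])
    show "((\<lambda>x. - (1 / Suc j) * exp (- (Suc j * \<theta> * x))) \<longlongrightarrow> 0) at_top"
    proof -
      have "((\<lambda>x. c * exp (- (a * x))) \<longlongrightarrow> 0) at_top" if "0 < a" for a c :: real
        using that by real_asymp
      from this[of "Suc j * \<theta>" "- (1 / Suc j)"] show ?thesis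
        using \<theta> by simp
    qed
    have *: "exp (- (j * \<theta> * x)) * exp (- \<theta> * x) = exp (- (Suc j * \<theta> * x))" for x :: real
      by (simp add: exp_add[symmetric] algebra_simps)
    show "((\<lambda>x. - (1 / Suc j) * exp (- (Suc j * \<theta> * x))) has_real_derivative
        exp (- (j * \<theta> * x)) * (\<theta> * exp (- \<theta> * x))) (at x)" for x
      unfolding mult.left_commute[of _ \<theta>] *
      by (rule derivative_eq_intros refl)+ (simp add: field_simps del: of_nat_Suc)
  qed auto
  moreover have "exp (- (j * \<theta> * m)) * (1 - exp (- \<theta> * m)) - (- (1 / Suc j) * exp (- (Suc j * \<theta> * m)))
     = exp (- (j * \<theta> * m)) - real j / Suc j * exp (- (Suc j * \<theta> * m))"
    by (simp add: exp_add[symmetric] field_simps exp_minus)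
  ultimately show ?thesis
    by simp
qed

text \<open>Independence makes the joint law a product measure, so Fubini allows the newest
  observation \<open>X\<close> to be integrated out with the past \<open>Y\<close> frozen.\<close>

lemma (in prob_space) indep_var_expectation_iterated:
  fixes f :: "'b \<times> 'b \<Rightarrow> real"
  assumes indep: "indep_var S Y T X" and f: "f \<in> borel_measurable (S \<Otimes>\<^sub>M T)"
    and int: "integrable M (\<lambda>\<omega>. f (Y \<omega>, X \<omega>))"
  shows "expectation (\<lambda>\<omega>. f (Y \<omega>, X \<omega>)) = expectation (\<lambda>\<omega>. expectation (\<lambda>\<omega>'. f (Y \<omega>, X \<omega>')))"
proof -
  note [measurable] = f indep_var_rv1[OF indep] indep_var_rv2[OF indep]
  have eq: "distr M S Y \<Otimes>\<^sub>M distr M T X = distr M (S \<Otimes>\<^sub>M T) (\<lambda>\<omega>. (Y \<omega>, X \<omega>))"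
    using indep by (simp add: indep_var_distribution_eq)
  interpret Y: prob_space "distr M S Y"
    by (rule prob_space_distr) measurable
  interpret X: prob_space "distr M T X"
    by (rule prob_space_distr) measurable
  interpret P: pair_prob_space "distr M S Y" "distr M T X" ..
  have "expectation (\<lambda>\<omega>. f (Y \<omega>, X \<omega>)) = integral\<^sup>L (distr M S Y \<Otimes>\<^sub>M distr M T X) f"
    unfolding eq by (rule integral_distr[symmetric]) measurable
  also have "\<dots> = (\<integral>y. (\<integral>x. f (y, x) \<partial>distr M T X) \<partial>distr M S Y)"
    by (rule P.integral_fst'[symmetric]) (simp add: eq integrable_distr_eq int)
  also have "\<dots> = expectation (\<lambda>\<omega>. \<integral>x. f (Y \<omega>, x) \<partial>distr M T X)"
    by (rule integral_distr) measurable
  also have "\<dots> = expectation (\<lambda>\<omega>. expectation (\<lambda>\<omega>'. f (Y \<omega>, X \<omega>')))"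
  proof (rule Bochner_Integration.integral_cong[OF refl])
    fix \<omega> assume "\<omega> \<in> space M"
    then have [measurable]: "(\<lambda>x. f (Y \<omega>, x)) \<in> borel_measurable T"
      using measurable_space[OF indep_var_rv1[OF indep]] by (intro measurable_compose[OF measurable_Pair1' f]) auto
    show "(\<integral>x. f (Y \<omega>, x) \<partial>distr M T X) = expectation (\<lambda>\<omega>'. f (Y \<omega>, X \<omega>'))"
      by (rule integral_distr) measurable
  qed
  finally show ?thesis .
qed


section \<open>Running maximum\<close>

text \<open>Starting at \<open>0\<close> keeps every value nonnegative, as the one-step formulas
  require of \<open>m\<close>; for exponential observations it alters the maximum only on a null
  set.\<close>

primrec running_max :: "(nat \<Rightarrow> real) \<Rightarrow> nat \<Rightarrow> real" where
  "running_max f 0 = 0"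
| "running_max f (Suc t) = max (running_max f t) (f (Suc t))"

lemma running_max_nonneg: "0 \<le> running_max f t"
  by (induction t) auto

lemma running_max_cong: "(\<And>i. i \<in> {1..t} \<Longrightarrow> f i = g i) \<Longrightarrow> running_max f t = running_max g t"
  by (induction t) auto

lemma running_max_eq_Max: "running_max f t = Max (insert 0 (f ` {1..t}))"
proof (induction t)
  case (Suc t)
  have "insert 0 (f ` {1..Suc t}) = insert (f (Suc t)) (insert 0 (f ` {1..t}))"
    by (auto simp: atLeastAtMostSuc_conv)
  then show ?case
    using Suc by (simp add: max.commute)
qed simp

lemma running_max_eq_Max_nonneg:
  assumes "1 \<le> t" and "\<And>i. i \<in> {1..t} \<Longrightarrow> 0 \<le> f i"
  shows "running_max f t = Max (f ` {1..t})"
proof -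
  have "0 \<le> Max (f ` {1..t})"
    using assms by (intro order_trans[OF assms(2)[of 1] Max_ge]) auto
  then show ?thesis
    using assms(1) by (simp add: running_max_eq_Max Max_insert)
qed

lemma measurable_running_max:
  "{1..t} \<subseteq> A \<Longrightarrow> (\<lambda>f. running_max f t) \<in> borel_measurable (PiM A (\<lambda>_. borel))"
proof (induction t)
  case (Suc t)
  then have "{1..t} \<subseteq> A" "Suc t \<in> A"
    by auto
  with Suc show ?case
    by (auto intro!: borel_measurable_max measurable_component_singleton)
qed simp

section \<open>The value recursion compared with harmonic numbers\<close>

primrec optimal_value :: "nat \<Rightarrow> real" where
  "optimal_value 0 = 0"
| "optimal_value (Suc k) = optimal_value k + exp (- optimal_value k)"

lemma optimal_value_nonneg: "0 \<le> optimal_value k"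
  by (induction k) (auto intro: add_nonneg_nonneg)

lemma ln_le_optimal_value: "ln (real k + 1) \<le> optimal_value k"
proof (induction k)
  case (Suc k)
  have "real k + 1 \<le> exp (optimal_value k)"
    using Suc ln_le_cancel_iff[of "real k + 1" "exp (optimal_value k)"] by simp
  \<comment> \<open>The right side is \<open>exp u + 1\<close> for
    \<open>u = optimal_value k\<close>; then \<open>1 + x \<le> exp x\<close> at
    \<open>x = exp (- u)\<close> bounds it by \<open>exp (u + exp (- u))\<close>.\<close>
  then have "real (Suc k) + 1 \<le> exp (optimal_value k) * (1 + exp (- optimal_value k))"
    by (simp add: algebra_simps exp_minus)
  also have "\<dots> \<le> exp (optimal_value k) * exp (exp (- optimal_value k))"
    by (intro mult_left_mono exp_ge_add_one_self) auto
  finally have "real (Suc k) + 1 \<le> exp (optimal_value (Suc k))"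
    by (simp add: exp_add)
  then show ?case
    using ln_le_cancel_iff[of "real (Suc k) + 1" "exp (optimal_value (Suc k))"] by simp
qed simp

lemma incseq_harm_diff_optimal_value: "incseq (\<lambda>k. harm k - optimal_value k)"
proof (rule incseq_SucI)
  fix k
  have "exp (- optimal_value k) \<le> exp (- ln (real k + 1))"
    using ln_le_optimal_value[of k] by simp
  also have "\<dots> = inverse (real (Suc k))"
    by (simp add: exp_minus add.commute)
  finally show "harm k - optimal_value k \<le> harm (Suc k) - optimal_value (Suc k)"
    by (simp add: harm_Suc)
qed

text \<open>The gap is \<open>0\<close> at \<open>k = 0\<close> and \<open>k = 1\<close>, so
  \<open>k = 2\<close> is the first index with a positive value; monotonicity carries it on.\<close>

lemma harm_diff_optimal_value_lower:
  assumes "2 \<le> k"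
  shows "1 / 2 - exp (- 1) \<le> harm k - optimal_value k"
proof -
  have "harm 2 - optimal_value 2 = 1 / 2 - exp (- 1)"
    by (simp add: numeral_2_eq_2 harm_Suc harm_expand)
  then show ?thesis
    using incseqD[OF incseq_harm_diff_optimal_value assms] by simp
qed

text \<open>\<open>harm k - ln k\<close> is nonincreasing and equals \<open>1\<close> at
  \<open>k = 1\<close>.\<close>

lemma harm_le_ln_add_one:
  assumes "1 \<le> k"
  shows "harm k \<le> ln (real k) + (1 :: real)"
proof -
  obtain j where "k = Suc j"
    using assms by (cases k) auto
  then show ?thesis
    using decseqD[OF decseq_harm_diff_ln, of 0 j] by (simp add: harm_expand)
qed

text \<open>The relative loss is \<open>(harm n - optimal_value n) / harm n\<close>, with numerator
  between \<open>2 * c\<close> and \<open>1\<close> and denominator between \<open>ln n\<close> and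
  \<open>2 * ln n\<close>. The halving in \<open>c\<close> pays for the factor \<open>2\<close> in
  the denominator.\<close>

lemma optimal_value_harm_gap:
  fixes c :: real
  assumes c: "c = (1 / 2 - exp (- 1)) / 2" and n: "3 \<le> n"
  shows "c * (1 / ln (real n)) \<le> 1 - optimal_value n / harm n"
    and "1 - optimal_value n / harm n \<le> 1 / ln (real n)"
proof -
  \<comment> \<open>From \<open>n = 3\<close> on, \<open>ln n\<close> exceeds \<open>1\<close>,
    which turns \<open>harm n \<le> ln n + 1\<close> into
    \<open>harm n \<le> 2 * ln n\<close>.\<close>
  have "1 < ln (3 :: real)"
    by (rule ln3_gt_1)
  also have "\<dots> \<le> ln (real n)"
    using n by simp
  finally have ln: "1 < ln (real n)" .
  have "ln (real n) \<le> ln (real n + 1)"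
    using n by simp
  then have harm: "ln (real n) \<le> harm n" "harm n \<le> 2 * ln (real n)"
    and gap: "harm n - optimal_value n \<le> 1"
    using ln_le_harm[of n] harm_le_ln_add_one[of n] ln_le_optimal_value[of n] n ln by linarith+
  have gap': "2 * c \<le> harm n - optimal_value n"
    using harm_diff_optimal_value_lower[of n] n by (simp add: c)
  have eq: "1 - optimal_value n / harm n = (harm n - optimal_value n) / harm n"
    using harm ln by (simp add: diff_divide_distrib)
  have "0 \<le> harm n - optimal_value n"
    using incseqD[OF incseq_harm_diff_optimal_value, of 0 n] by (simp add: harm_expand)
  then show "1 - optimal_value n / harm n \<le> 1 / ln (real n)"
    unfolding eq using gap harm(1) ln by (intro frac_le) linarith+
  have "c * (1 / ln (real n)) = 2 * c / (2 * ln (real n))"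
    by simp
  also have "\<dots> \<le> (harm n - optimal_value n) / harm n"
    using \<open>0 \<le> harm n - optimal_value n\<close> gap' harm ln by (intro frac_le) linarith+
  finally show "c * (1 / ln (real n)) \<le> 1 - optimal_value n / harm n"
    unfolding eq .
qed

lemma has_bochner_integral_mono:
  fixes x y :: real
  assumes "has_bochner_integral M f x" and "has_bochner_integral M g y"
    and "\<And>\<omega>. \<omega> \<in> space M \<Longrightarrow> f \<omega> \<le> g \<omega>"
  shows "x \<le> y"
  using assms by (auto simp: has_bochner_integral_iff intro: integral_mono)

section \<open>Expected maximum of i.i.d. exponential observations\<close>

text \<open>The horizon and the law are fixed here; the asymptotic statement instantiates this
  setting separately for each large \<open>n\<close>.\<close>

locale iid_exponential = prob_space M for M :: "'a measure" +
  fixes n :: nat and X :: "nat \<Rightarrow> 'a \<Rightarrow> real" and \<theta> :: real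
  assumes \<theta>_pos: "0 < \<theta>"
    and indep: "indep_vars (\<lambda>_. borel) X {1..n}"
    and distributed_X: "\<And>t. t \<in> {1..n} \<Longrightarrow> distributed M lborel (X t) (exponential_density \<theta>)"
begin

lemma measurable_X: "t \<in> {1..n} \<Longrightarrow> X t \<in> borel_measurable M"
  using distributed_measurable[OF distributed_X] by simp

lemma AE_X_nonneg: "t \<in> {1..n} \<Longrightarrow> AE \<omega> in M. 0 \<le> X t \<omega>"
  by (subst distributed_AE2[OF distributed_X]) (auto simp: exponential_density_def)

lemma expectation_max_X:
  "t \<in> {1..n} \<Longrightarrow> 0 \<le> m \<Longrightarrow> has_bochner_integral M (\<lambda>\<omega>. max m (X t \<omega>)) (m + exp (- \<theta> * m) / \<theta>)"
  using exponential_expectation_max distributed_X \<theta>_pos by blast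

lemma integrable_X:
  assumes t: "t \<in> {1..n}"
  shows "integrable M (X t)"
proof -
  have "integrable M (\<lambda>\<omega>. max 0 (X t \<omega>))"
    using expectation_max_X[OF t, of 0] by (auto simp: has_bochner_integral_iff)
  then show ?thesis
    using AE_X_nonneg[OF t] measurable_X[OF t]
    by (subst integrable_cong_AE[where g = "\<lambda>\<omega>. max 0 (X t \<omega>)"]) (auto elim: eventually_mono)
qed

text \<open>The index blocks \<open>{1..<i}\<close> and \<open>{i}\<close> are disjoint. Both the
  running maximum and indicators of past events are used as \<open>g\<close>.\<close>

lemma indep_past:
  assumes i: "i \<in> {1..n}" and g: "g \<in> borel_measurable (PiM {1..<i} (\<lambda>_. borel))"
  shows "indep_var borel (\<lambda>\<omega>. g (restrict (\<lambda>k. X k \<omega>) {1..<i})) borel (X i)"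
proof -
  have "indep_var borel (g \<circ> (\<lambda>\<omega>. restrict (\<lambda>k. X k \<omega>) {1..<i}))
      borel ((\<lambda>f. f i) \<circ> (\<lambda>\<omega>. restrict (\<lambda>k. X k \<omega>) {i}))"
    using i by (intro indep_var_compose[OF indep_var_restrict[OF indep]] g) auto
  then show ?thesis
    by (simp add: comp_def)
qed

lemma indep_running_max:
  assumes "Suc t \<le> n"
  shows "indep_var borel (\<lambda>\<omega>. running_max (\<lambda>k. X k \<omega>) t) borel (X (Suc t))"
proof -
  have "indep_var borel (\<lambda>\<omega>. running_max (restrict (\<lambda>k. X k \<omega>) {1..<Suc t}) t) borel (X (Suc t))"
    using assms by (intro indep_past measurable_running_max) auto
  moreover have "running_max (restrict (\<lambda>k. X k \<omega>) {1..<Suc t}) t = running_max (\<lambda>k. X k \<omega>) t" for \<omega>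
    by (rule running_max_cong) auto
  ultimately show ?thesis
    by simp
qed

lemma measurable_running_max_X:
  "t \<le> n \<Longrightarrow> (\<lambda>\<omega>. running_max (\<lambda>k. X k \<omega>) t) \<in> borel_measurable M"
  by (induction t) (auto intro!: borel_measurable_max measurable_X)

lemma integrable_running_max: "t \<le> n \<Longrightarrow> integrable M (\<lambda>\<omega>. running_max (\<lambda>k. X k \<omega>) t)"
  by (induction t) (auto intro!: integrable_max integrable_X)

lemma integrable_exp_running_max:
  assumes "t \<le> n"
  shows "integrable M (\<lambda>\<omega>. exp (- (real j * \<theta> * running_max (\<lambda>k. X k \<omega>) t)))"
proof (rule integrable_const_bound[where B = 1])
  show "(\<lambda>\<omega>. exp (- (real j * \<theta> * running_max (\<lambda>k. X k \<omega>) t))) \<in> borel_measurable M"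
    using measurable_running_max_X[OF assms] by measurable
qed (use \<theta>_pos running_max_nonneg in auto)

text \<open>Adding an observation turns the moment of order \<open>j\<close> into one involving order \<open>j + 1\<close>, so all orders
  are computed together although only \<open>j = 1\<close> is needed for the expected maximum.\<close>

lemma expectation_exp_running_max:
  "t \<le> n \<Longrightarrow> expectation (\<lambda>\<omega>. exp (- (real j * \<theta> * running_max (\<lambda>k. X k \<omega>) t))) =
    fact t * fact j / fact (t + j)"
proof (induction t arbitrary: j)
  case 0
  then show ?case
    by (simp add: prob_space)
next
  case (Suc t)
  let ?R = "\<lambda>\<omega>. running_max (\<lambda>k. X k \<omega>) t"
  have "expectation (\<lambda>\<omega>. exp (- (real j * \<theta> * running_max (\<lambda>k. X k \<omega>) (Suc t)))) =
      expectation (\<lambda>\<omega>. expectation (\<lambda>\<omega>'. exp (- (real j * \<theta> * max (?R \<omega>) (X (Suc t) \<omega>')))))"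
    using indep_var_expectation_iterated[OF indep_running_max, of t
        "\<lambda>(y, x). exp (- (real j * \<theta> * max y x))"] Suc.prems integrable_exp_running_max[of "Suc t" j]
    by simp
  also have "\<dots> = expectation (\<lambda>\<omega>. exp (- (real j * \<theta> * ?R \<omega>))
      - real j / Suc j * exp (- (real (Suc j) * \<theta> * ?R \<omega>)))"
    using Suc.prems running_max_nonneg
    by (intro Bochner_Integration.integral_cong refl has_bochner_integral_integral_eq
        exponential_expectation_exp_max distributed_X \<theta>_pos) auto
  also have "\<dots> = fact t * fact j / fact (t + j) - real j / Suc j * (fact t * fact (Suc j) / fact (t + Suc j))"
    using Suc.prems
    by (subst Bochner_Integration.integral_diff)
      (auto intro!: integrable_mult_right integrable_exp_running_max simp: Suc.IH simp del: of_nat_Suc)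
  \<comment> \<open>Over the common denominator \<open>fact (t + j + 1)\<close> the numerators leave
    the factor \<open>(t + j + 1) - j = t + 1\<close>.\<close>
  also have "\<dots> = fact (Suc t) * fact j / fact (Suc t + j)"
  proof -
    have "fact t * fact j / fact (t + j) = fact t * fact j * (real t + real j + 1) / fact (Suc (t + j))"
      by (simp add: divide_simps)
    moreover have "real j / Suc j * (fact t * fact (Suc j) / fact (t + Suc j)) =
        fact t * fact j * real j / fact (Suc (t + j))"
      by simp
    ultimately show ?thesis
      by (simp only: diff_divide_distrib[symmetric]) (simp add: algebra_simps)
  qed
  finally show ?case .
qed

text \<open>The mean increment at stage \<open>t + 1\<close> is the moment of order \<open>1\<close>
  divided by \<open>\<theta>\<close>, and that moment is \<open>1 / (t + 1)\<close>: a harmonic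
  term.\<close>

lemma expectation_running_max:
  "t \<le> n \<Longrightarrow> expectation (\<lambda>\<omega>. running_max (\<lambda>k. X k \<omega>) t) = harm t / \<theta>"
proof (induction t)
  case 0
  then show ?case
    by (simp add: harm_expand)
next
  case (Suc t)
  let ?R = "\<lambda>\<omega>. running_max (\<lambda>k. X k \<omega>) t"
  have "expectation (\<lambda>\<omega>. running_max (\<lambda>k. X k \<omega>) (Suc t)) =
      expectation (\<lambda>\<omega>. expectation (\<lambda>\<omega>'. max (?R \<omega>) (X (Suc t) \<omega>')))"
    using indep_var_expectation_iterated[OF indep_running_max, of t "\<lambda>(y, x). max y x"]
      Suc.prems integrable_running_max[of "Suc t"]
    by simp
  \<comment> \<open>Writing \<open>real 1\<close> puts the exponential into the shape of the moment
    formula at \<open>j = 1\<close>.\<close>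
  also have "\<dots> = expectation (\<lambda>\<omega>. ?R \<omega> + exp (- (real 1 * \<theta> * ?R \<omega>)) / \<theta>)"
    using Suc.prems running_max_nonneg expectation_max_X[of "Suc t"]
    by (intro Bochner_Integration.integral_cong refl has_bochner_integral_integral_eq) auto
  also have "\<dots> = harm t / \<theta> + fact t * fact 1 / fact (t + 1) / \<theta>"
    using Suc.prems integrable_exp_running_max[of t 1] integrable_running_max[of t]
      expectation_exp_running_max[of t 1] Suc.IH
    by (subst Bochner_Integration.integral_add) auto
  also have "\<dots> = harm (Suc t) / \<theta>"
    by (simp add: harm_Suc add_divide_distrib inverse_eq_divide)
  finally show ?case .
qed

text \<open>Almost surely all observations are nonnegative, so the initial \<open>0\<close> of
  \<open>running_max\<close> is invisible; \<open>1 \<le> n\<close> makes the set under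
  \<open>Max\<close> nonempty.\<close>

lemma OPT_eq_harm:
  assumes "1 \<le> n"
  shows "OPT M n X = harm n / \<theta>"
proof -
  have "AE \<omega> in M. \<forall>t\<in>{1..n}. 0 \<le> X t \<omega>"
    by (intro AE_finite_allI AE_X_nonneg) auto
  then have "AE \<omega> in M. running_max (\<lambda>t. X t \<omega>) n = Max ((\<lambda>t. X t \<omega>) ` {1..n})"
    by (rule eventually_mono) (rule running_max_eq_Max_nonneg[OF assms], blast)
  moreover have "(\<lambda>\<omega>. Max ((\<lambda>t. X t \<omega>) ` {1..n})) \<in> borel_measurable M"
    by (intro borel_measurable_Max measurable_X) auto
  ultimately show ?thesis
    unfolding OPT_def expectation_running_max[OF order_refl, symmetric]
    by (intro integral_cong_AE) (auto intro: measurable_running_max_X elim: eventually_mono)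
qed


section \<open>Histories and events of the past\<close>

lemma measurable_padded: "padded n X t \<in> borel_measurable M"
proof (cases "t \<in> {1..n}")
  case True
  then have "padded n X t = X t"
    by (auto simp: padded_def)
  then show ?thesis
    using measurable_X[OF True] by simp
next
  case False
  then have "padded n X t = (\<lambda>_. 0)"
    by (auto simp: padded_def)
  then show ?thesis
    by simp
qed

abbreviation history :: "nat \<Rightarrow> 'a measure" where
  "history \<equiv> natural_filtration M (padded n X)"

lemma space_history: "space (history t) = space M"
  using filtration_natural_filtration by (rule filtration.space_F)

lemma sets_history:
  "sets (history t) = sigma_sets (space M) (\<Union>i\<in>{1..t}. {padded n X i -` B \<inter> space M | B. B \<in> sets borel})"
  unfolding natural_filtration_def by (rule sets_measure_of) auto

lemma sets_history_subset: "sets (history t) \<subseteq> sets M"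
  unfolding sets_history
  by (rule sets.sigma_sets_subset) (auto intro: measurable_sets[OF measurable_padded])

lemma measurable_padded_history: "s \<in> {1..t} \<Longrightarrow> padded n X s \<in> borel_measurable (history t)"
  unfolding measurable_def sets_history space_history by (fastforce intro: sigma_sets.Basic)

text \<open>Preimages under the vector of the first \<open>i - 1\<close> observations form a
  sigma-algebra containing the generators of the history, hence the whole history.\<close>

lemma past_event:
  assumes i: "i \<in> {1..n}" and A: "A \<in> sets (history (i - 1))"
  obtains C where "C \<in> sets (PiM {1..<i} (\<lambda>_. borel))"
    and "A = {\<omega>\<in>space M. restrict (\<lambda>k. X k \<omega>) {1..<i} \<in> C}"
proof -
  let ?P = "PiM {1..<i} (\<lambda>_. borel) :: (nat \<Rightarrow> real) measure"
  let ?r = "\<lambda>\<omega>. restrict (\<lambda>k. X k \<omega>) {1..<i}"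
  have r: "?r \<in> space M \<rightarrow> space ?P"
    by (auto simp: space_PiM)
  have "sets (history (i - 1)) \<subseteq> sets (vimage_algebra (space M) ?r ?P)"
  proof (subst sets_history, rule sets.sigma_sets_subset', safe)
    fix k B assume k: "k \<in> {1..i - 1}" and B: "B \<in> sets (borel :: real measure)"
    have "1 \<le> k" "k < i" "k \<le> n"
      using k i by auto
    \<comment> \<open>Since \<open>k < i\<close> and \<open>i \<le> n\<close>, the padding is
      inactive and a generator is the preimage of a cylinder set.\<close>
    then have "padded n X k -` B \<inter> space M = ?r -` ((\<lambda>f. f k) -` B \<inter> space ?P) \<inter> space M"
      using r by (auto simp: padded_def \<open>k < i\<close> \<open>1 \<le> k\<close> \<open>k \<le> n\<close>)
    moreover have "(\<lambda>f. f k) -` B \<inter> space ?P \<in> sets ?P"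
      using k B by (intro measurable_sets[OF measurable_component_singleton]) auto
    ultimately show "padded n X k -` B \<inter> space M \<in> sets (vimage_algebra (space M) ?r ?P)"
      by (simp only: in_vimage_algebra)
  next
    show "space M \<in> sets (vimage_algebra (space M) ?r ?P)"
      using sets.top[of "vimage_algebra (space M) ?r ?P"] by simp
  qed
  then obtain C where "C \<in> sets ?P" "A = ?r -` C \<inter> space M"
    using A unfolding sets_vimage_algebra2[OF r] by blast
  then show thesis
    by (intro that[of C]) auto
qed

text \<open>An event decided before stage \<open>i\<close> is independent of \<open>X i\<close>, so
  the expectation factors. This stands in for conditioning on the history.\<close>

lemma expectation_max_on_past_event:
  assumes i: "i \<in> {1..n}" and A: "A \<in> sets (history (i - 1))" and v: "0 \<le> v"
  shows "has_bochner_integral M (\<lambda>\<omega>. indicator A \<omega> * max v (X i \<omega>)) (prob A * (v + exp (- \<theta> * v) / \<theta>))"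
proof -
  obtain C where C: "C \<in> sets (PiM {1..<i} (\<lambda>_. borel))"
    and A_eq: "A = {\<omega>\<in>space M. restrict (\<lambda>k. X k \<omega>) {1..<i} \<in> C}"
    using past_event[OF i A] by blast
  \<comment> \<open>Independence is stated for functions of the past vector, so \<open>A\<close> is
    represented through \<open>C\<close>; the two indicators agree on
    \<open>space M\<close>.\<close>
  have "indep_var borel (\<lambda>\<omega>. indicator C (restrict (\<lambda>k. X k \<omega>) {1..<i}) :: real) borel (X i)"
    using C by (intro indep_past i) simp
  then have "indep_var borel (id \<circ> (\<lambda>\<omega>. indicator C (restrict (\<lambda>k. X k \<omega>) {1..<i}) :: real))
      borel (max v \<circ> X i)"
    by (rule indep_var_compose) auto
  then have ind: "indep_var borel (\<lambda>\<omega>. indicator C (restrict (\<lambda>k. X k \<omega>) {1..<i}) :: real)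
      borel (\<lambda>\<omega>. max v (X i \<omega>))"
    by (simp add: comp_def)
  have A_sets: "A \<in> sets M"
    using A sets_history_subset by blast
  have ind_eq: "indicator C (restrict (\<lambda>k. X k \<omega>) {1..<i}) = (indicator A \<omega> :: real)"
    if "\<omega> \<in> space M" for \<omega>
    using that by (simp add: A_eq indicator_def)
  have int_A: "has_bochner_integral M (\<lambda>\<omega>. indicator C (restrict (\<lambda>k. X k \<omega>) {1..<i})) (prob A)"
    using has_bochner_integral_real_indicator[OF A_sets] ind_eq
    by (subst has_bochner_integral_cong[OF refl _ refl, where g = "indicator A"])
      (auto simp: emeasure_eq_measure)
  have "has_bochner_integral M
      (\<lambda>\<omega>. indicator C (restrict (\<lambda>k. X k \<omega>) {1..<i}) * max v (X i \<omega>))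
      (prob A * (v + exp (- \<theta> * v) / \<theta>))"
    using indep_var_integrable[OF ind] indep_var_lebesgue_integral[OF ind] int_A
      expectation_max_X[OF i v]
    by (simp add: has_bochner_integral_iff)
  then show ?thesis
    by (rule has_bochner_integral_cong[OF refl _ refl, THEN iffD1, rotated]) (simp only: ind_eq)
qed

section \<open>Upper bound for the reward of any policy\<close>

text \<open>This makes still being active after stage \<open>t\<close> an admissible past event for
  stage \<open>Suc t\<close>.\<close>

lemma policy_after_in_history:
  assumes "is_policy M n X \<sigma>"
  shows "{\<omega>\<in>space M. t < \<sigma> \<omega>} \<in> sets (history t)"
  using stopping_timeD2[of history \<sigma> t] assms
  by (simp add: is_policy_def Measurable.pred_def space_history)

lemma policy_at_in_sets:
  assumes "is_policy M n X \<sigma>"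
  shows "{\<omega>\<in>space M. \<sigma> \<omega> = Suc t} \<in> sets M"
proof -
  have "{\<omega>\<in>space M. \<sigma> \<omega> = Suc t} = {\<omega>\<in>space M. t < \<sigma> \<omega>} - {\<omega>\<in>space M. Suc t < \<sigma> \<omega>}"
    by auto
  then show ?thesis
    using policy_after_in_history[OF assms] sets_history_subset by (auto intro!: sets.Diff)
qed

lemma integrable_reward_at:
  assumes "is_policy M n X \<sigma>" and "t < n"
  shows "integrable M (\<lambda>\<omega>. indicator {\<omega>\<in>space M. \<sigma> \<omega> = Suc t} \<omega> * X (Suc t) \<omega>)"
  using integrable_mult_indicator[OF policy_at_in_sets[OF assms(1)] integrable_X[of "Suc t"]] assms(2)
  by simp

text \<open>Split by the stopping stage; stopping at \<open>n + 1\<close> pays \<open>0\<close>.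
  Numbering stages as \<open>Suc t\<close> prepares the telescoping sum.\<close>

lemma expected_reward_eq_sum:
  assumes \<sigma>: "is_policy M n X \<sigma>"
  shows "expected_reward M n X \<sigma> =
    (\<Sum>t<n. expectation (\<lambda>\<omega>. indicator {\<omega>\<in>space M. \<sigma> \<omega> = Suc t} \<omega> * X (Suc t) \<omega>))"
proof -
  have "padded n X (\<sigma> \<omega>) \<omega> = (\<Sum>t<n. indicator {\<omega>\<in>space M. \<sigma> \<omega> = Suc t} \<omega> * X (Suc t) \<omega>)"
    if "\<omega> \<in> space M" for \<omega>
  proof -
    have "(\<Sum>t<n. indicator {\<omega>\<in>space M. \<sigma> \<omega> = Suc t} \<omega> * X (Suc t) \<omega>) =
        (\<Sum>t\<in>{1..n}. if \<sigma> \<omega> = t then X t \<omega> else 0)"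
      using that by (intro sum.reindex_bij_witness[of _ "\<lambda>t. t - 1" Suc]) (auto simp: indicator_def)
    then show ?thesis
      by (simp add: padded_def)
  qed
  then have "expected_reward M n X \<sigma> =
      expectation (\<lambda>\<omega>. \<Sum>t<n. indicator {\<omega>\<in>space M. \<sigma> \<omega> = Suc t} \<omega> * X (Suc t) \<omega>)"
    unfolding expected_reward_def by (intro Bochner_Integration.integral_cong) auto
  also have "\<dots> = (\<Sum>t<n. expectation (\<lambda>\<omega>. indicator {\<omega>\<in>space M. \<sigma> \<omega> = Suc t} \<omega> * X (Suc t) \<omega>))"
    using integrable_reward_at[OF \<sigma>] by (intro Bochner_Integration.integral_sum) simp
  finally show ?thesis .
qed

text \<open>The value of going on after rejecting the first \<open>t\<close> observations; it is
  \<open>0\<close> at \<open>t = n\<close>.\<close>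

abbreviation continuation_value :: "nat \<Rightarrow> real" where
  "continuation_value t \<equiv> optimal_value (n - t) / \<theta>"

text \<open>The first integrand is the better of accepting and continuing at stage
  \<open>Suc t\<close>, the second what \<open>\<sigma>\<close> gets there if continuing is paid its
  value. Comparing them pointwise yields both the upper bound and its attainment.\<close>

lemma stage_integrals:
  assumes \<sigma>: "is_policy M n X \<sigma>" and t: "t < n"
  shows "has_bochner_integral M
      (\<lambda>\<omega>. indicator {\<omega>\<in>space M. t < \<sigma> \<omega>} \<omega> * max (continuation_value (Suc t)) (X (Suc t) \<omega>))
      (prob {\<omega>\<in>space M. t < \<sigma> \<omega>} * continuation_value t)"
    and "has_bochner_integral M
      (\<lambda>\<omega>. indicator {\<omega>\<in>space M. \<sigma> \<omega> = Suc t} \<omega> * X (Suc t) \<omega> +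
        continuation_value (Suc t) * indicator {\<omega>\<in>space M. Suc t < \<sigma> \<omega>} \<omega>)
      (expectation (\<lambda>\<omega>. indicator {\<omega>\<in>space M. \<sigma> \<omega> = Suc t} \<omega> * X (Suc t) \<omega>) +
        continuation_value (Suc t) * prob {\<omega>\<in>space M. Suc t < \<sigma> \<omega>})"
proof -
  \<comment> \<open>This exposes the recursion of \<open>optimal_value\<close>; in the exponent
    \<open>\<theta>\<close> cancels against the scaling.\<close>
  have "n - t = Suc (n - Suc t)"
    using t by simp
  then have "continuation_value (Suc t) + exp (- \<theta> * continuation_value (Suc t)) / \<theta> = continuation_value t"
    using \<theta>_pos by (simp add: add_divide_distrib)
  then show "has_bochner_integral M
      (\<lambda>\<omega>. indicator {\<omega>\<in>space M. t < \<sigma> \<omega>} \<omega> * max (continuation_value (Suc t)) (X (Suc t) \<omega>))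
      (prob {\<omega>\<in>space M. t < \<sigma> \<omega>} * continuation_value t)"
    using expectation_max_on_past_event[of "Suc t" "{\<omega>\<in>space M. t < \<sigma> \<omega>}" "continuation_value (Suc t)"]
      policy_after_in_history[OF \<sigma>, of t] t \<theta>_pos optimal_value_nonneg
    by simp
  have "{\<omega>\<in>space M. Suc t < \<sigma> \<omega>} \<in> sets M"
    using policy_after_in_history[OF \<sigma>] sets_history_subset by blast
  then have "has_bochner_integral M (indicator {\<omega>\<in>space M. Suc t < \<sigma> \<omega>}) (prob {\<omega>\<in>space M. Suc t < \<sigma> \<omega>})"
    by (intro has_bochner_integral_real_indicator) (auto simp: emeasure_eq_measure)
  then show "has_bochner_integral M
      (\<lambda>\<omega>. indicator {\<omega>\<in>space M. \<sigma> \<omega> = Suc t} \<omega> * X (Suc t) \<omega> +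
        continuation_value (Suc t) * indicator {\<omega>\<in>space M. Suc t < \<sigma> \<omega>} \<omega>)
      (expectation (\<lambda>\<omega>. indicator {\<omega>\<in>space M. \<sigma> \<omega> = Suc t} \<omega> * X (Suc t) \<omega>) +
        continuation_value (Suc t) * prob {\<omega>\<in>space M. Suc t < \<sigma> \<omega>})"
    by (intro has_bochner_integral_add has_bochner_integral_mult_right
        has_bochner_integral_integrable integrable_reward_at[OF \<sigma> t])
qed

text \<open>Replacing the reward after stage \<open>t\<close> by the continuation value gives a total that is nonincreasing in
  \<open>t\<close>, and constant for the threshold policy; its increments telescope.\<close>

lemma sum_stage_values:
  assumes \<sigma>: "is_policy M n X \<sigma>"
  shows "(\<Sum>t<n. prob {\<omega>\<in>space M. t < \<sigma> \<omega>} * continuation_value t -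
      continuation_value (Suc t) * prob {\<omega>\<in>space M. Suc t < \<sigma> \<omega>}) = optimal_value n / \<theta>"
proof -
  \<comment> \<open>The first term of the telescope has probability \<open>1\<close> because
    policies start at \<open>1\<close>; the last vanishes with
    \<open>optimal_value 0\<close>.\<close>
  have "{\<omega>\<in>space M. 0 < \<sigma> \<omega>} = space M"
    using \<sigma> by (fastforce simp: is_policy_def)
  then show ?thesis
    using sum_lessThan_telescope'[of "\<lambda>t. prob {\<omega>\<in>space M. t < \<sigma> \<omega>} * continuation_value t" n]
    by (simp add: mult.commute prob_space)
qed

text \<open>At each stage the option taken by \<open>\<sigma>\<close> is at most the maximum of the
  two; the stagewise bounds telescope.\<close>

lemma expected_reward_le:
  assumes \<sigma>: "is_policy M n X \<sigma>"
  shows "expected_reward M n X \<sigma> \<le> optimal_value n / \<theta>"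
  unfolding expected_reward_eq_sum[OF \<sigma>] sum_stage_values[OF \<sigma>, symmetric]
proof (rule sum_mono)
  fix t assume "t \<in> {..<n}"
  then have "t < n"
    by simp
  have "expectation (\<lambda>\<omega>. indicator {\<omega>\<in>space M. \<sigma> \<omega> = Suc t} \<omega> * X (Suc t) \<omega>) +
        continuation_value (Suc t) * prob {\<omega>\<in>space M. Suc t < \<sigma> \<omega>} \<le>
      prob {\<omega>\<in>space M. t < \<sigma> \<omega>} * continuation_value t"
    by (rule has_bochner_integral_mono[OF stage_integrals(2,1)[OF \<sigma> \<open>t < n\<close>]])
      (auto simp: indicator_def)
  then show "expectation (\<lambda>\<omega>. indicator {\<omega>\<in>space M. \<sigma> \<omega> = Suc t} \<omega> * X (Suc t) \<omega>) \<le>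
      prob {\<omega>\<in>space M. t < \<sigma> \<omega>} * continuation_value t -
        continuation_value (Suc t) * prob {\<omega>\<in>space M. Suc t < \<sigma> \<omega>}"
    by simp
qed

section \<open>The threshold policy attains the bound\<close>

text \<open>The implication makes \<open>n + 1\<close> always qualify, so the least element exists
  and encodes accepting nothing as \<open>n + 1\<close>.\<close>

definition threshold_policy :: "'a \<Rightarrow> nat" where
  "threshold_policy \<omega> = (LEAST t. 1 \<le> t \<and> (t \<le> n \<longrightarrow> continuation_value t \<le> X t \<omega>))"

lemma threshold_policy_stops:
  "1 \<le> threshold_policy \<omega> \<and>
    (threshold_policy \<omega> \<le> n \<longrightarrow> continuation_value (threshold_policy \<omega>) \<le> X (threshold_policy \<omega>) \<omega>)"
  unfolding threshold_policy_def
  by (rule LeastI[of "\<lambda>t. 1 \<le> t \<and> (t \<le> n \<longrightarrow> continuation_value t \<le> X t \<omega>)" "n + 1"]) simp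

lemma threshold_policy_le:
  "1 \<le> t \<Longrightarrow> (t \<le> n \<Longrightarrow> continuation_value t \<le> X t \<omega>) \<Longrightarrow> threshold_policy \<omega> \<le> t"
  unfolding threshold_policy_def by (rule Least_le) simp

lemma is_policy_threshold_policy: "is_policy M n X threshold_policy"
  unfolding is_policy_def
proof (intro conjI stopping_timeI ballI)
  fix t
  \<comment> \<open>Stopping by \<open>t\<close> becomes a finite union of events in the history,
    phrased with \<open>padded n X\<close> because that process generates it.\<close>
  have eq: "threshold_policy \<omega> \<le> t \<longleftrightarrow> (\<exists>s\<in>{1..t}. s \<le> n \<longrightarrow> continuation_value s \<le> padded n X s \<omega>)" for \<omega>
  proof
    assume "threshold_policy \<omega> \<le> t"
    then show "\<exists>s\<in>{1..t}. s \<le> n \<longrightarrow> continuation_value s \<le> padded n X s \<omega>"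
      using threshold_policy_stops[of \<omega>] by (intro bexI[of _ "threshold_policy \<omega>"]) (auto simp: padded_def)
  next
    assume "\<exists>s\<in>{1..t}. s \<le> n \<longrightarrow> continuation_value s \<le> padded n X s \<omega>"
    then obtain s where "s \<in> {1..t}" "s \<le> n \<longrightarrow> continuation_value s \<le> padded n X s \<omega>"
      by blast
    then show "threshold_policy \<omega> \<le> t"
      using threshold_policy_le[of s \<omega>] by (simp add: padded_def)
  qed
  show "Measurable.pred (history t) (\<lambda>\<omega>. threshold_policy \<omega> \<le> t)"
    unfolding eq
  proof (intro pred_intros_finite pred_intros_imp')
    fix s assume "s \<in> {1..t}"
    note [measurable] = measurable_padded_history[OF this]
    show "Measurable.pred (history t) (\<lambda>\<omega>. continuation_value s \<le> padded n X s \<omega>)"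
      by measurable
  qed simp
next
  show "threshold_policy \<omega> \<in> {1..n + 1}" for \<omega>
    using conjunct1[OF threshold_policy_stops] threshold_policy_le[of "n + 1" \<omega>] by simp
qed

text \<open>An active threshold policy accepts exactly when the observation reaches the continuation
  value, so it always takes the maximum and each stagewise inequality becomes an equality.\<close>

lemma expected_reward_threshold_policy: "expected_reward M n X threshold_policy = optimal_value n / \<theta>"
  unfolding expected_reward_eq_sum[OF is_policy_threshold_policy]
    sum_stage_values[OF is_policy_threshold_policy, symmetric]
proof (rule sum.cong[OF refl])
  fix t assume "t \<in> {..<n}"
  then have t: "t < n"
    by simp
  let ?\<sigma> = threshold_policy
  have "expectation (\<lambda>\<omega>. indicator {\<omega>\<in>space M. ?\<sigma> \<omega> = Suc t} \<omega> * X (Suc t) \<omega>) +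
        continuation_value (Suc t) * prob {\<omega>\<in>space M. Suc t < ?\<sigma> \<omega>} =
      prob {\<omega>\<in>space M. t < ?\<sigma> \<omega>} * continuation_value t"
  proof (rule has_bochner_integral_eq[OF stage_integrals(2)[OF is_policy_threshold_policy t]],
      rule has_bochner_integral_cong[OF refl _ refl, THEN iffD1, rotated,
        OF stage_integrals(1)[OF is_policy_threshold_policy t]])
    fix \<omega> assume \<omega>: "\<omega> \<in> space M"
    consider "?\<sigma> \<omega> \<le> t" | "?\<sigma> \<omega> = Suc t" | "Suc t < ?\<sigma> \<omega>"
      by linarith
    then show "indicator {\<omega>\<in>space M. t < ?\<sigma> \<omega>} \<omega> * max (continuation_value (Suc t)) (X (Suc t) \<omega>) =
        indicator {\<omega>\<in>space M. ?\<sigma> \<omega> = Suc t} \<omega> * X (Suc t) \<omega> +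
        continuation_value (Suc t) * indicator {\<omega>\<in>space M. Suc t < ?\<sigma> \<omega>} \<omega>"
    proof cases
      case 2
      then have "continuation_value (Suc t) \<le> X (Suc t) \<omega>"
        using threshold_policy_stops[of \<omega>] t by simp
      then show ?thesis
        using 2 \<omega> by simp
    next
      case 3
      then have "X (Suc t) \<omega> < continuation_value (Suc t)"
        using threshold_policy_le[of "Suc t" \<omega>] by force
      then show ?thesis
        using 3 \<omega> by simp
    qed simp
  qed
  then show "expectation (\<lambda>\<omega>. indicator {\<omega>\<in>space M. ?\<sigma> \<omega> = Suc t} \<omega> * X (Suc t) \<omega>) =
      prob {\<omega>\<in>space M. t < ?\<sigma> \<omega>} * continuation_value t -
        continuation_value (Suc t) * prob {\<omega>\<in>space M. Suc t < ?\<sigma> \<omega>}"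
    by simp
qed

section \<open>The competitive ratio and its asymptotics\<close>

text \<open>An optimal policy obeys the upper bound and does at least as well as the threshold
  policy, which attains it; \<open>\<theta>\<close> cancels in the ratio.\<close>

lemma CR_optimal_policy:
  assumes "1 \<le> n" and "is_optimal_policy M n X \<tau>"
  shows "CR M n X \<tau> = optimal_value n / harm n"
proof -
  have "expected_reward M n X \<tau> = optimal_value n / \<theta>"
  proof (rule order_antisym)
    show "expected_reward M n X \<tau> \<le> optimal_value n / \<theta>"
      using assms(2) by (intro expected_reward_le) (simp add: is_optimal_policy_def)
    show "optimal_value n / \<theta> \<le> expected_reward M n X \<tau>"
      unfolding expected_reward_threshold_policy[symmetric]
      using assms(2) is_policy_threshold_policy unfolding is_optimal_policy_def by blast
  qed
  then show ?thesis
    using \<theta>_pos by (simp add: CR_def OPT_eq_harm[OF assms(1)])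
qed

end

theorem proposition13:
  fixes \<theta> :: real
    and M :: "nat \<Rightarrow> 'a measure"
    and X :: "nat \<Rightarrow> nat \<Rightarrow> 'a \<Rightarrow> real"
    and \<tau> :: "nat \<Rightarrow> 'a \<Rightarrow> nat"
  assumes "\<theta> > 0"
    and "\<And>n. n \<ge> 1 \<Longrightarrow> prob_space (M n)"
    and "\<And>n. n \<ge> 1 \<Longrightarrow> prob_space.indep_vars (M n) (\<lambda>_. borel) (X n) {1..n}"
    and "\<And>n t. n \<ge> 1 \<Longrightarrow> t \<in> {1..n} \<Longrightarrow>
           distributed (M n) lborel (X n t) (exponential_density \<theta>)"
    and "\<And>n. n \<ge> 1 \<Longrightarrow> is_optimal_policy (M n) n (X n) (\<tau> n)"
  shows "one_minus_Theta (\<lambda>n. CR (M n) n (X n) (\<tau> n)) (\<lambda>n. 1 / ln (real n))"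
proof -
  define c :: real where "c = (1 / 2 - exp (- 1)) / 2"
  \<comment> \<open>Positivity of \<open>c\<close> amounts to \<open>exp 1 > 2\<close>, which
    follows from \<open>(1 + 1/2)^2 = 9/4 \<le> exp 1\<close>.\<close>
  have "2 < exp (1 :: real)"
    using exp_ge_one_plus_x_over_n_power_n[of 2 1] by (simp add: power2_eq_square)
  from less_imp_inverse_less[OF this] have "0 < c"
    by (simp add: c_def exp_minus)
  moreover have "c * (1 / ln (real n)) \<le> 1 - CR (M n) n (X n) (\<tau> n) \<and>
      1 - CR (M n) n (X n) (\<tau> n) \<le> 1 * (1 / ln (real n))" if n: "3 \<le> n" for n
  proof -
    have n1: "1 \<le> n"
      using n by simp
    interpret prob_space "M n"
      by (rule assms(2)[OF n1])
    interpret iid_exponential "M n" n "X n" \<theta>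
      by unfold_locales (use assms(1) assms(3,4)[OF n1] in blast)+
    have "CR (M n) n (X n) (\<tau> n) = optimal_value n / harm n"
      by (rule CR_optimal_policy[OF n1 assms(5)[OF n1]])
    then show ?thesis
      using optimal_value_harm_gap[OF c_def n] by (simp only: mult_1)
  qed
  ultimately show ?thesis
    unfolding one_minus_Theta_def
    by (intro exI[of _ c] exI[of _ 1] conjI eventually_sequentiallyI[of 3]) (simp_all del: mult_1)
qed

end
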